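(* Let $f$ be the canonical extension of a real-analytic function $g:\mathbb{R}\to\mathbb{R}$, let $\mathbf{a},\mathbf{b}\in\mathbb{R}^{\mathbb{Z}_{<}}$ be finite, and let $a=\operatorname{St}(\mathbf{a})$, $b=\operatorname{St}(\mathbf{b})$. Then $$\operatorname{St}\!\left(\int_{\mathbf{a}}^{\mathbf{b}}f(\mathbf{x})\,d\mathbf{x}\right)=\int_a^b g(x)\,dx,$$ where the integral on the left is the algebraic integral and the right-hand side is the classical Riemann integral of $g$.
   Context: $\mathbb{R}^{\mathbb{Z}_{<}}$ is the field of all two-sided real sequences $\mathbf{x}=(x_n)_{n\in\mathbb{Z}}$ for which there exists $N$ with $x_n=0$ for all $n<-N$, with componentwise addition and Cauchy convolution $(\mathbf{x}\cdot\mathbf{y})_n=\sum_{k\in\mathbb{Z}}x_k y_{n-k}$. The valuation is $\operatorname{val}(\mathbf{x})=\min\{n:x_n\ne 0\}$, $\operatorname{val}(0)=\infty$. The field is totally ordered by: $\mathbf{x}<\mathbf{y}$ iff $\mathbf{x}\neq\mathbf{y}$ and $y_n-x_n>0$ for $n=\operatorname{val}(\mathbf{y}-\mathbf{x})$. Reals $r$ are identified with the sequence having $r$ at index $0$ and $0$ elsewhere. $\mathcal{F}$ is the ring of finite elements, i.e. those $\mathbf{x}$ with $|\mathbf{x}|<r$ for some $r\in\mathbb{R}$, and $\operatorname{St}(\mathbf{x})=x_0$ for $\mathbf{x}\in\mathcal{F}$. The valuation topology is the one induced by the ultrametric $d(\mathbf{x},\mathbf{y})=2^{-\operatorname{val}(\mathbf{x}-\mathbf{y})}$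 (with $2^{-\infty}=0$). The canonical extension of a real-analytic $g:\mathbb{R}\to\mathbb{R}$ is the function $f:\mathcal{F}\to\mathbb{R}^{\mathbb{Z}_{<}}$, $f(\mathbf{x})=\sum_{k=0}^{\infty}\frac{g^{(k)}(\operatorname{St}(\mathbf{x}))}{k!}\bigl(\mathbf{x}-\operatorname{St}(\mathbf{x})\bigr)^k$, the series converging in the valuation topology. Algebraic integral: let $G$ be any real antiderivative of $g$ (so $G'=g$; $G$ is real-analytic) and let $F$ be the canonical extension of $G$. For finite $\mathbf{a},\mathbf{b}$, $\int_{\mathbf{a}}^{\mathbf{b}}f(\mathbf{x})\,d\mathbf{x}:=F(\mathbf{b})-F(\mathbf{a})\in\mathbb{R}^{\mathbb{Z}_{<}}$, which does not depend on the choice of $G$. *)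

theory Defs
  imports "HOL-Analysis.Analysis" "HOL-Computational_Algebra.Formal_Laurent_Series"
begin

unbundle fps_syntax

text \<open>
  The field of two-sided real sequences that vanish far enough to the left, with Cauchy convolution
  as multiplication, is the type \<^typ>\<open>real fls\<close> of formal Laurent series; a real number \<open>r\<close> is
  identified with \<^term>\<open>fls_const r\<close>. The valuation of a nonzero \<open>x\<close> is \<^term>\<open>fls_subdegree x\<close>,
  and the library metric on \<^typ>\<open>real fls\<close> is \<open>d(x,y) = 2 powr - val (x - y)\<close>, so that limits and
  \<^const>\<open>suminf\<close> on this type refer to the valuation topology. The convention
  \<open>fls_subdegree 0 = 0\<close> (in place of infinity) is harmless: the valuation is only used at nonzero
  elements.
\<close>

instantiation fls :: (linordered_field) linordered_field
begin

definition less_fls :: "'a fls \<Rightarrow> 'a fls \<Rightarrow> bool"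
  where "less_fls x y \<longleftrightarrow> x \<noteq> y \<and> (y - x) $$ fls_subdegree (y - x) > 0"

definition less_eq_fls :: "'a fls \<Rightarrow> 'a fls \<Rightarrow> bool"
  where "less_eq_fls x y \<longleftrightarrow> x < y \<or> x = y"

definition abs_fls :: "'a fls \<Rightarrow> 'a fls"
  where "abs_fls x = (if x < 0 then - x else x)"

definition sgn_fls :: "'a fls \<Rightarrow> 'a fls"
  where "sgn_fls x = (if x = 0 then 0 else if 0 < x then 1 else - 1)"

instance
proof -
  define P where "P = (\<lambda>x :: 'a fls. x $$ fls_subdegree x > 0)"
  have less: "x < y \<longleftrightarrow> P (y - x)" for x y
    by (auto simp: less_fls_def P_def)
  have P_uminus: "P (- x)" if "x \<noteq> 0" "\<not> P x" for x
    using that nth_fls_subdegree_nonzero[of x] by (auto simp: P_def not_less less_le)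
  have P_not: "\<not> P (- x)" if "P x" for x
    using that by (auto simp: P_def)
  have P_0: "\<not> P 0" 
    by (simp add: P_def)
  have P_add: "P (x + y)" if "P x" "P y" for x y
  proof -
    define m where "m = min (fls_subdegree x) (fls_subdegree y)"
    have "z $$ n \<ge> 0" if "P z" "n \<le> fls_subdegree z" for z :: "'a fls" and n
      using that by (cases "n = fls_subdegree z") (auto simp: P_def)
    with that have nonneg: "x $$ m \<ge> 0" "y $$ m \<ge> 0"
      by (simp_all add: m_def)
    have pos: "(x + y) $$ m > 0"
      using that nonneg by (auto simp: P_def m_def min_def add_pos_nonneg add_nonneg_pos split: if_splits)
    have "fls_subdegree (x + y) = m"
      by (rule fls_subdegree_eqI) (use pos in \<open>auto simp: m_def\<close>)
    with pos show ?thesis by (simp add: P_def)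
  qed
  have P_mult: "P (x * y)" if "P x" "P y" for x y
    using that by (simp add: P_def fls_mult_nonzero_base_subdegree_eq)
  show "OFCLASS('a fls, linordered_field_class)"
  proof
    fix x y z :: "'a fls"
    show "x < y \<longleftrightarrow> x \<le> y \<and> \<not> y \<le> x"
      using P_not[of "y - x"] P_0 by (auto simp: less_eq_fls_def less)
    show "x \<le> x"
      by (simp add: less_eq_fls_def)
    show "x \<le> z" if "x \<le> y" "y \<le> z"
      using that P_add[of "z - y" "y - x"] by (auto simp: less_eq_fls_def less)
    show "x = y" if "x \<le> y" "y \<le> x"
      using that P_not[of "y - x"] by (auto simp: less_eq_fls_def less)
    show "x \<le> y \<or> y \<le> x"
      using P_uminus[of "y - x"] by (auto simp: less_eq_fls_def less)
    show "z + x \<le> z + y" if "x \<le> y"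
      using that by (auto simp: less_eq_fls_def less)
    show "z * x < z * y" if "x < y" "0 < z"
      using that P_mult[of z "y - x"] by (simp add: less right_diff_distrib)
    show "\<bar>x\<bar> = (if x < 0 then - x else x)"
      by (rule abs_fls_def)
    show "sgn x = (if x = 0 then 0 else if 0 < x then 1 else - 1)"
      by (rule sgn_fls_def)
  qed
qed

end

definition finite_elements :: "real fls set"
  where "finite_elements = {x. \<exists>r. \<bar>x\<bar> < fls_const r}"

text \<open>
  The standard part and canonical extensions have the finite elements as their domain; outside of
  it they take the value \<^const>\<open>undefined\<close>. An equation for the standard part of \<open>x\<close> therefore
  carries the content that \<open>x\<close> is finite.
\<close>

definition St :: "real fls \<Rightarrow> real"
  where "St = (\<lambda>x\<in>finite_elements. x $$ 0)"

definition real_analytic :: "(real \<Rightarrow> real) \<Rightarrow> bool"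
  where "real_analytic g \<longleftrightarrow>
    (\<forall>x. \<exists>c. \<exists>r>0. \<forall>y. \<bar>y - x\<bar> < r \<longrightarrow> (\<lambda>n. c n * (y - x) ^ n) sums g y)"

definition canonical_extension :: "(real \<Rightarrow> real) \<Rightarrow> real fls \<Rightarrow> real fls"
  where "canonical_extension g =
    (\<lambda>x\<in>finite_elements.
       \<Sum>k. fls_const ((deriv ^^ k) g (St x) / fact k) * (x - fls_const (St x)) ^ k)"

text \<open>
  The algebraic integral is a function of the integrand \<open>f\<close> on the finite elements. Both the
  underlying real function \<open>g\<close> (determined by \<open>f\<close>) and its antiderivative \<open>G\<close> (determined up to
  a constant) are quantified in the description, whose value does not depend on them.
\<close>

definition algebraic_integral :: "real fls \<Rightarrow> real fls \<Rightarrow> (real fls \<Rightarrow> real fls) \<Rightarrow> real fls"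
  where "algebraic_integral a b f =
    (THE I. \<exists>g G. real_analytic g \<and> f = canonical_extension g \<and>
       (\<forall>x. (G has_real_derivative g x) (at x)) \<and>
       I = canonical_extension G b - canonical_extension G a)"

text \<open>
  The oriented integral over \<open>[a, b]\<close>, allowing \<open>b < a\<close>. The gauge integral of the library agrees
  with the Riemann integral on every Riemann integrable function.
\<close>

definition oriented_integral :: "real \<Rightarrow> real \<Rightarrow> (real \<Rightarrow> real) \<Rightarrow> real"
  where "oriented_integral a b g =
    (if a \<le> b then integral {a..b} g else - integral {b..a} g)"

end

theory Submission
  imports Defs
begin

unbundle no vec_syntax

text \<open>
  At a finite point \<open>x\<close> the difference \<open>x - St x\<close> is a power series without constant term, so the
  series defining a canonical extension is the composition of the Taylor series with that power
  series. Its constant coefficient is the value of the real function at \<open>St x\<close>, which reduces the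
  theorem to the fundamental theorem of calculus. The algebraic integral is well defined because
  \<open>f\<close> restricted to the reals is \<open>g\<close>, and because antiderivatives differ by a constant.
\<close>

text \<open>A term of negative index outweighs every real constant. Finite elements are thus exactly
  the embedded power series, to which composition applies.\<close>

lemma finite_elements_iff: "x \<in> finite_elements \<longleftrightarrow> fls_subdegree x \<ge> 0"
proof
  assume "x \<in> finite_elements"
  then obtain r where r: "\<bar>x\<bar> < fls_const r"
    by (auto simp: finite_elements_def)
  show "fls_subdegree x \<ge> 0"
  proof (rule ccontr)
    assume "\<not> fls_subdegree x \<ge> 0"
    hence neg: "fls_subdegree \<bar>x\<bar> < 0" and "\<bar>x\<bar> \<noteq> 0"
      by (auto simp: abs_fls_def)
    have "\<bar>x\<bar> \<ge> 0" by simp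
    with \<open>\<bar>x\<bar> \<noteq> 0\<close> have "\<bar>x\<bar> > 0" by (simp only: order.strict_iff_order) auto
    hence lead: "\<bar>x\<bar> $$ fls_subdegree \<bar>x\<bar> > 0"
      by (simp add: less_fls_def del: zero_less_abs_iff)
    \<comment> \<open>The constant only touches index 0, so the difference keeps the leading term of
      \<open>\<bar>x\<bar>\<close>, now with a negative sign.\<close>
    have "fls_subdegree (fls_const r - \<bar>x\<bar>) = fls_subdegree \<bar>x\<bar>"
      by (rule fls_subdegree_eqI) (use neg lead in auto)
    with r lead neg show False
      by (auto simp: less_fls_def)
  qed
next
  assume nonneg: "fls_subdegree x \<ge> 0"
  \<comment> \<open>The summand 1 makes coefficient 0 of \<open>fls_const r - \<bar>x\<bar>\<close>
    strictly positive, hence leading.\<close>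
  define r where "r = \<bar>\<bar>x\<bar> $$ 0\<bar> + 1"
  have nonneg': "fls_subdegree \<bar>x\<bar> \<ge> 0"
    using nonneg by (simp add: abs_fls_def)
  have pos: "r - \<bar>x\<bar> $$ 0 > 0"
    by (simp add: r_def)
  have "fls_subdegree (fls_const r - \<bar>x\<bar>) = 0"
    by (rule fls_subdegree_eqI) (use pos nonneg' in auto)
  with pos have "\<bar>x\<bar> < fls_const r"
    by (auto simp: less_fls_def)
  thus "x \<in> finite_elements"
    by (auto simp: finite_elements_def)
qed

lemma fls_const_finite: "fls_const r \<in> finite_elements"
  by (simp add: finite_elements_iff)

lemma fps_to_fls_finite: "fps_to_fls F \<in> finite_elements"
  by (simp add: finite_elements_iff fls_subdegree_fls_to_fps)

lemma diff_finite: "x \<in> finite_elements \<Longrightarrow> y \<in> finite_elements \<Longrightarrow> x - y \<in> finite_elements"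
  by (metis finite_elements_iff fls_regpart_to_fls_trivial fps_to_fls_finite fps_to_fls_minus)

lemma St_eq: "x \<in> finite_elements \<Longrightarrow> St x = x $$ 0"
  by (simp add: St_def)

lemma St_fls_const: "St (fls_const r) = r"
  by (simp add: St_eq fls_const_finite)

text \<open>Being an isometry, the embedding carries convergent series of power series over to the
  valuation topology.\<close>

lemma dist_fps_to_fls: "dist (fps_to_fls F) (fps_to_fls G) = dist F (G :: 'a :: ab_group_add fps)"
  by (simp add: dist_fls_def dist_fps_def fls_subdegree_fls_to_fps flip: fps_to_fls_minus)

text \<open>Since \<open>H ^ n\<close> vanishes below index \<open>n\<close>, each coefficient of
  the partial sums is eventually constant.\<close>

lemma sums_fps_compose:
  fixes F H :: "'a :: comm_ring_1 fps"
  assumes "H $ 0 = 0"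
  shows "(\<lambda>n. fps_const (F $ n) * H ^ n) sums (F oo H)"
  unfolding sums_def
proof (rule tendsto_fpsI)
  fix j
  have "(\<Sum>i<n. fps_const (F $ i) * H ^ i) $ j = (F oo H) $ j" if "n > j" for n
    unfolding fps_compose_nth fps_sum_nth fps_mult_left_const_nth
    using that startsby_zero_power_prefix[OF assms]
    by (intro sum.mono_neutral_right) auto
  thus "\<forall>\<^sub>F n in sequentially. (\<Sum>i<n. fps_const (F $ i) * H ^ i) $ j = (F oo H) $ j"
    using eventually_gt_at_top by (rule eventually_mono[rotated])
qed

lemma fps_to_fls_sum: "fps_to_fls (\<Sum>i\<in>A. f i) = (\<Sum>i\<in>A. fps_to_fls (f i))"
  by (induction A rule: infinite_finite_induct) simp_all

lemma sums_fps_to_fls: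
  fixes F :: "'a :: ab_group_add fps"
  shows "f sums F \<Longrightarrow> (\<lambda>n. fps_to_fls (f n)) sums fps_to_fls F"
  unfolding sums_def tendsto_dist_iff[of _ F] tendsto_dist_iff[of _ "fps_to_fls F"]
  by (simp add: dist_fps_to_fls flip: fps_to_fls_sum)

lemma canonical_extension_eq_compose:
  assumes "x \<in> finite_elements"
  shows "canonical_extension g x =
    fps_to_fls (Abs_fps (\<lambda>k. (deriv ^^ k) g (St x) / fact k) oo (fls_regpart x - fps_const (St x)))"
    (is "_ = fps_to_fls (?F oo ?H)")
proof -
  have H0: "?H $ 0 = 0"
    by (simp add: St_eq assms)
  \<comment> \<open>By finiteness, \<open>fls_regpart x\<close> loses no coefficient of
    \<open>x\<close>.\<close>
  have "fps_to_fls ?H = x - fls_const (St x)"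
    using assms by (simp add: finite_elements_iff)
  with sums_fps_to_fls[OF sums_fps_compose[OF H0, of ?F]]
  have "(\<lambda>k. fls_const ((deriv ^^ k) g (St x) / fact k) * (x - fls_const (St x)) ^ k)
      sums fps_to_fls (?F oo ?H)"
    by (simp add: fls_times_fps_to_fls fps_to_fls_power)
  with assms show ?thesis
    by (simp add: canonical_extension_def sums_iff)
qed

lemma canonical_extension_finite:
  "x \<in> finite_elements \<Longrightarrow> canonical_extension g x \<in> finite_elements"
  by (subst canonical_extension_eq_compose) (assumption, rule fps_to_fls_finite)

lemma St_canonical_extension:
  "x \<in> finite_elements \<Longrightarrow> St (canonical_extension g x) = g (St x)"
  using St_eq[OF canonical_extension_finite, of x g]
  by (simp only: canonical_extension_eq_compose) simp

lemma canonical_extension_inject: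
  assumes "canonical_extension g = canonical_extension h"
  shows "g = h"
proof
  fix x
  show "g x = h x"
    using St_canonical_extension[OF fls_const_finite, of g x]
      St_canonical_extension[OF fls_const_finite, of h x] assms
    by (simp add: St_fls_const)
qed

text \<open>Only the Taylor coefficient of order 0 changes, and composition is additive and fixes
  constants.\<close>

lemma canonical_extension_add_const:
  assumes "x \<in> finite_elements"
  shows "canonical_extension (\<lambda>y. g y + c) x = canonical_extension g x + fls_const c"
proof -
  \<comment> \<open>\<open>deriv\<close> chooses some \<open>D\<close> with this property, so the
    equivalence for all \<open>D\<close> equates both derivatives even where \<open>g\<close> is not
    differentiable.\<close>
  have "((\<lambda>y. g y + c) has_real_derivative D) (at y) \<longleftrightarrow> (g has_real_derivative D) (at y)" for D y
  proof
    show "(g has_real_derivative D) (at y)" if "((\<lambda>y. g y + c) has_real_derivative D) (at y)"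
      using DERIV_add[OF that DERIV_const[of "- c"]] by simp
    show "((\<lambda>y. g y + c) has_real_derivative D) (at y)" if "(g has_real_derivative D) (at y)"
      using DERIV_add[OF that DERIV_const[of c]] by simp
  qed
  hence "deriv (\<lambda>y. g y + c) = deriv g"
    by (simp add: deriv_def fun_eq_iff)
  hence "(deriv ^^ Suc k) (\<lambda>y. g y + c) = (deriv ^^ Suc k) g" for k
    by (simp add: funpow_Suc_right del: funpow.simps)
  hence "(deriv ^^ k) (\<lambda>y. g y + c) = (if k = 0 then (\<lambda>y. g y + c) else (deriv ^^ k) g)" for k
    by (cases k) simp_all
  hence "Abs_fps (\<lambda>k. (deriv ^^ k) (\<lambda>y. g y + c) (St x) / fact k) =
      Abs_fps (\<lambda>k. (deriv ^^ k) g (St x) / fact k) + fps_const c"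
    by (simp add: fps_eq_iff)
  thus ?thesis
    using assms(1) by (simp add: canonical_extension_eq_compose fps_compose_add_distrib)
qed

text \<open>The constant \<open>H 0 - G 0\<close> by which the antiderivatives differ cancels
  between the endpoints.\<close>

lemma canonical_extension_antiderivative_diff:
  assumes G: "\<And>x. (G has_real_derivative g x) (at x)"
    and H: "\<And>x. (H has_real_derivative g x) (at x)"
    and "a \<in> finite_elements" "b \<in> finite_elements"
  shows "canonical_extension H b - canonical_extension H a =
    canonical_extension G b - canonical_extension G a"
proof -
  have "((\<lambda>x. H x - G x) has_real_derivative 0) (at x)" for x
    using DERIV_diff[OF H G, of x] by simp
  hence "H x - G x = H 0 - G 0" for x
    by (rule DERIV_isconst_all[rule_format])
  hence "H = (\<lambda>x. G x + (H 0 - G 0))"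
    by (auto simp: fun_eq_iff algebra_simps)
  thus ?thesis
    using canonical_extension_add_const[of _ G "H 0 - G 0"] assms(3,4) by simp
qed

lemma real_analytic_isCont:
  assumes "real_analytic g"
  shows "isCont g x"
proof -
  obtain c r where r: "r > 0" and sums: "\<And>y. \<bar>y - x\<bar> < r \<Longrightarrow> (\<lambda>n. c n * (y - x) ^ n) sums g y"
    using assms unfolding real_analytic_def by blast
  \<comment> \<open>Convergence at distance \<open>r / 2\<close> puts the centre strictly inside the
    disc of convergence.\<close>
  have "summable (\<lambda>n. c n * (r / 2) ^ n)"
    using sums[of "x + r / 2"] r by (simp add: sums_iff)
  hence "isCont (\<lambda>h. \<Sum>n. c n * h ^ n) (x - x)"
    by (rule isCont_powser) (use r in simp)
  hence "isCont (\<lambda>y. \<Sum>n. c n * (y - x) ^ n) x"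
    by (rule isCont_o2[where f = "\<lambda>y. y - x", rotated]) simp
  moreover have "\<forall>\<^sub>F y in nhds x. (\<Sum>n. c n * (y - x) ^ n) = g y"
    unfolding eventually_nhds_metric dist_real_def using r sums by (auto simp: sums_iff)
  ultimately show ?thesis
    by (simp add: isCont_cong)
qed

text \<open>The interval from \<open>-\<infinity>\<close> to \<open>\<infinity>\<close> yields one
  antiderivative on the whole line.\<close>

lemma isCont_ex_antiderivative:
  fixes g :: "real \<Rightarrow> real"
  assumes "\<And>x. isCont g x"
  obtains G where "\<And>x. (G has_real_derivative g x) (at x)"
  using einterval_antiderivative[of "-\<infinity>" \<infinity> g] assms
  by (auto simp: has_real_derivative_iff_has_vector_derivative)

lemma algebraic_integral_eq:
  assumes "real_analytic g" and "\<And>x. (G has_real_derivative g x) (at x)"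
    and "a \<in> finite_elements" "b \<in> finite_elements"
  shows "algebraic_integral a b (canonical_extension g) =
    canonical_extension G b - canonical_extension G a"
  unfolding algebraic_integral_def
proof (rule the_equality)
  fix I
  assume "\<exists>h H. real_analytic h \<and> canonical_extension g = canonical_extension h \<and>
    (\<forall>x. (H has_real_derivative h x) (at x)) \<and>
    I = canonical_extension H b - canonical_extension H a"
  thus "I = canonical_extension G b - canonical_extension G a"
    \<comment> \<open>Injectivity forces \<open>h = g\<close>, so \<open>H\<close> and
      \<open>G\<close> are antiderivatives of the same function.\<close>
    using canonical_extension_antiderivative_diff[OF assms(2) _ assms(3,4)]
    by (metis canonical_extension_inject)
qed (use assms in blast)

lemma oriented_integral_eq:
  assumes "\<And>x. (G has_real_derivative g x) (at x)"
  shows "oriented_integral a b g = G b - G a"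
proof -
  \<comment> \<open>Free endpoints serve both orientations.\<close>
  have "(g has_integral G v - G u) {u..v}" if "u \<le> v" for u v
    using that assms
    by (intro fundamental_theorem_of_calculus)
       (auto intro: has_field_derivative_at_within simp flip: has_real_derivative_iff_has_vector_derivative)
  from integral_unique[OF this] show ?thesis
    by (simp add: oriented_integral_def)
qed

theorem theorem8p1:
  fixes g :: "real \<Rightarrow> real" and f :: "real fls \<Rightarrow> real fls" and a b :: "real fls"
  assumes "real_analytic g"
    and "f = canonical_extension g"
    and "a \<in> finite_elements" and "b \<in> finite_elements"
  shows "St (algebraic_integral a b f) = oriented_integral (St a) (St b) g"
proof -
  obtain G where G: "\<And>x. (G has_real_derivative g x) (at x)"
    using isCont_ex_antiderivative real_analytic_isCont[OF assms(1)] by blast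
  \<comment> \<open>\<open>St\<close> reads off coefficient 0 only at finite elements, so the
    difference of the two extensions must be finite as well.\<close>
  have "St (algebraic_integral a b f) = St (canonical_extension G b) - St (canonical_extension G a)"
    using assms(3,4) algebraic_integral_eq[OF assms(1) G assms(3,4)]
    by (simp add: assms(2) St_eq diff_finite canonical_extension_finite)
  also have "\<dots> = G (St b) - G (St a)"
    by (simp add: St_canonical_extension assms(3,4))
  also have "\<dots> = oriented_integral (St a) (St b) g"
    by (rule oriented_integral_eq[OF G, symmetric])
  finally show ?thesis .
qed

end
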